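(* Let $G$ be a finite group and let $T$ be a minimal separating set of the power graph $\mathcal{G}(G)$. Then for any $x \in G$, either $[x] \subseteq T$ or $[x] \cap T = \emptyset$. Hence $T$ is a union of some $\approx$-classes.
   Context: $\mathbb{N}$ denotes the positive integers. The power graph $\mathcal{G}(G)$ of a group $G$ is the simple undirected graph with vertex set $G$ in which two distinct vertices $u,v$ are adjacent if $v=u^\alpha$ for some $\alpha\in\mathbb{N}$ or $u=v^\beta$ for some $\beta\in\mathbb{N}$. The relation $\approx$ on $G$ is the equivalence relation defined by $x\approx y$ if $\langle x\rangle=\langle y\rangle$ (equality of generated cyclic subgroups); $[x]$ denotes the equivalence class of $x$, and a $\approx$-class is an equivalence class of $\approx$. A separating set of a graph $\Gamma$ is a set of vertices whose removal increases the number of components of $\Gamma$. A separating set is minimal if none of its non-empty proper subsets disconnects $\Gamma$ when removed. *)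

theory Defs
  imports "HOL-Algebra.Generated_Groups" "HOL-Algebra.Multiplicative_Group"
    "Graph_Theory.Graph_Theory"
begin

(* Following Graph_Theory, a simple undirected graph is a loop-free symmetric digraph without
   parallel arcs: every edge is represented by its two orientations. *)

definition power_graph :: "('a, 'b) monoid_scheme \<Rightarrow> 'a pair_pre_digraph" where
  "power_graph G =
     \<lparr> pverts = carrier G,
       parcs = {(u, v). u \<in> carrier G \<and> v \<in> carrier G \<and> u \<noteq> v \<and>
         ((\<exists>\<alpha>::nat. \<alpha> > 0 \<and> v = u [^]\<^bsub>G\<^esub> \<alpha>) \<or> (\<exists>\<beta>::nat. \<beta> > 0 \<and> u = v [^]\<^bsub>G\<^esub> \<beta>))} \<rparr>"

definition same_cyclic_rel :: "('a, 'b) monoid_scheme \<Rightarrow> ('a \<times> 'a) set" where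
  "same_cyclic_rel G =
     {(x, y). x \<in> carrier G \<and> y \<in> carrier G \<and> generate G {x} = generate G {y}}"

definition remove_verts :: "('a, 'b) pre_digraph \<Rightarrow> 'a set \<Rightarrow> ('a, 'b) pre_digraph" where
  "remove_verts \<Gamma> S = \<Gamma> \<restriction> (verts \<Gamma> - S)"

(* The components of an undirected graph are the strongly connected components of the
   corresponding symmetric digraph; the null graph has none.  Meaningful for finite graphs only,
   as card is 0 on infinite sets. *)
definition num_components :: "('a, 'b) pre_digraph \<Rightarrow> nat" where
  "num_components \<Gamma> = card (pre_digraph.sccs \<Gamma>)"

definition separating_set :: "('a, 'b) pre_digraph \<Rightarrow> 'a set \<Rightarrow> bool" where
  "separating_set \<Gamma> S \<longleftrightarrow>
     S \<subseteq> verts \<Gamma> \<and> num_components \<Gamma> < num_components (remove_verts \<Gamma> S)"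

(* A set "disconnects" the graph if removing it increases the number of components.
   Lemma separating_set_power_graph_iff below shows that, for proper vertex subsets of a finite
   power graph, this is the same as leaving a graph that is not connected. *)
definition minimal_separating_set :: "('a, 'b) pre_digraph \<Rightarrow> 'a set \<Rightarrow> bool" where
  "minimal_separating_set \<Gamma> T \<longleftrightarrow>
     separating_set \<Gamma> T \<and> \<not> (\<exists>S. S \<noteq> {} \<and> S \<subset> T \<and> separating_set \<Gamma> S)"

lemma equiv_same_cyclic_rel: "equiv (carrier G) (same_cyclic_rel G)"
  by (rule equivI) (auto simp: same_cyclic_rel_def refl_on_def sym_def trans_def)

lemma pair_graph_power_graph:
  assumes "finite (carrier G)"
  shows "pair_graph (power_graph G)"
proof -
  have "finite (parcs (power_graph G))"
    by (rule finite_subset[of _ "carrier G \<times> carrier G"]) (auto simp: power_graph_def assms)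
  then show ?thesis
    using assms by unfold_locales (auto simp: power_graph_def symmetric_def intro!: symI)
qed

lemma (in fin_digraph) num_components_eq_1_iff:
  assumes "verts G \<noteq> {}"
  shows "num_components G = 1 \<longleftrightarrow> strongly_connected G"
proof
  have cover: "\<exists>S\<in>sccs_verts. u \<in> S" if "u \<in> verts G" for u
    using scc_of_in_sccs_verts[OF that] that by (intro bexI[of _ "scc_of u"]) (auto simp: scc_of_def)
  assume "num_components G = 1"
  then obtain S where "sccs_verts = {S}"
    by (auto simp: num_components_def card_1_singleton_iff simp flip: card_sccs_verts)
  then have "S \<in> sccs_verts" and "verts G \<subseteq> S" using cover by auto
  from \<open>S \<in> sccs_verts\<close> have "\<forall>u\<in>S. \<forall>v\<in>S. u \<rightarrow>\<^sup>* v"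
    by (simp add: sccs_verts_def)
  then have "u \<rightarrow>\<^sup>* v" if "u \<in> verts G" "v \<in> verts G" for u v
    using that \<open>verts G \<subseteq> S\<close> by blast
  then show "strongly_connected G" using assms by (rule strongly_connectedI[rotated])
next
  assume sc: "strongly_connected G"
  have uniq: "S = verts G" if "S \<in> sccs_verts" for S
  proof -
    have sub: "S \<subseteq> verts G" using that by (rule sccs_verts_subsets)
    have ne: "S \<noteq> {}" and max: "\<forall>u\<in>S. \<forall>v. v \<notin> S \<longrightarrow> \<not> u \<rightarrow>\<^sup>* v \<or> \<not> v \<rightarrow>\<^sup>* u"
      using that by (simp_all add: sccs_verts_def)
    from ne obtain u where u: "u \<in> S" by blast
    have "v \<in> S" if v: "v \<in> verts G" for v
    proof -
      have "u \<in> verts G" using u sub by (rule rev_subsetD)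
      then have "u \<rightarrow>\<^sup>* v" "v \<rightarrow>\<^sup>* u"
        using sc v by (simp_all only: strongly_connected_def)
      then show ?thesis using max u by blast
    qed
    then show ?thesis using sub by blast
  qed
  obtain u where "u \<in> verts G" using assms by blast
  then have scc: "scc_of u \<in> sccs_verts" by (rule scc_of_in_sccs_verts)
  then have "verts G \<in> sccs_verts" by (simp only: uniq[OF scc])
  moreover have "sccs_verts \<subseteq> {verts G}" by (rule subsetI) (simp only: singleton_iff, rule uniq)
  ultimately have "sccs_verts = {verts G}" by (simp only: subset_singleton_iff) blast
  then show "num_components G = 1" by (simp add: num_components_def flip: card_sccs_verts)
qed

lemma connected_power_graph:
  assumes "group G" "finite (carrier G)"
  shows "strongly_connected (with_proj (power_graph G))"
proof -
  interpret G: group G by fact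
  interpret P: pair_graph "power_graph G" by (rule pair_graph_power_graph) fact
  have V: "pverts (power_graph G) = carrier G" by (simp add: power_graph_def)
  have adj: "(x, \<one>\<^bsub>G\<^esub>) \<in> parcs (power_graph G) \<and> (\<one>\<^bsub>G\<^esub>, x) \<in> parcs (power_graph G)"
    if "x \<in> carrier G" "x \<noteq> \<one>\<^bsub>G\<^esub>" for x
  proof -
    have "group.ord G x > 0" "x [^]\<^bsub>G\<^esub> group.ord G x = \<one>\<^bsub>G\<^esub>"
      using that assms(2) G.ord_ge_1[of x] G.pow_ord_eq_1[of x] by simp_all
    then have "\<exists>\<alpha>::nat. \<alpha> > 0 \<and> \<one>\<^bsub>G\<^esub> = x [^]\<^bsub>G\<^esub> \<alpha>" by metis
    then show ?thesis using that by (simp add: power_graph_def)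
  qed
  have one: "x \<rightarrow>\<^sup>*\<^bsub>with_proj (power_graph G)\<^esub> \<one>\<^bsub>G\<^esub> \<and> \<one>\<^bsub>G\<^esub> \<rightarrow>\<^sup>*\<^bsub>with_proj (power_graph G)\<^esub> x"
    if "x \<in> carrier G" for x
  proof (cases "x = \<one>\<^bsub>G\<^esub>")
    case True
    then show ?thesis using that V P.reachable_refl by simp
  next
    case False
    then show ?thesis using adj[OF that] by (simp add: P.reachable_adjI)
  qed
  show ?thesis
    unfolding strongly_connected_def
  proof (intro conjI ballI)
    show "verts (with_proj (power_graph G)) \<noteq> {}" using V G.one_closed by auto
    fix u v
    assume "u \<in> verts (with_proj (power_graph G))" "v \<in> verts (with_proj (power_graph G))"
    then have "u \<in> carrier G" "v \<in> carrier G" using V by simp_all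
    then show "u \<rightarrow>\<^sup>*\<^bsub>with_proj (power_graph G)\<^esub> v"
      by (rule P.reachable_trans[OF conjunct1[OF one] conjunct2[OF one]])
  qed
qed

lemma separating_set_power_graph_iff:
  assumes "group G" "finite (carrier G)" "S \<subset> carrier G"
  shows "separating_set (with_proj (power_graph G)) S \<longleftrightarrow>
    \<not> connected (remove_verts (with_proj (power_graph G)) S)"
proof -
  let ?P = "with_proj (power_graph G)"
  let ?H = "remove_verts ?P S"
  have V: "verts ?P = carrier G" by (simp add: power_graph_def)
  interpret P: pair_graph "power_graph G" by (rule pair_graph_power_graph) fact
  have fP: "fin_digraph ?P" and wP: "wf_digraph ?P" by unfold_locales
  have ind: "induced_subgraph ?H ?P"
    unfolding remove_verts_def by (rule wf_digraph.induced_induce[OF wP]) auto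
  interpret H: fin_digraph ?H by (rule fin_digraph.fin_digraph_subgraph[OF fP induced_imp_subgraph[OF ind]])
  have sym: "symmetric ?H" using P.sym_arcs ind by (rule induced_graph_imp_symmetric)
  interpret H: sym_digraph ?H using sym by unfold_locales
  have ne: "verts ?H \<noteq> {}" using assms(3) V by (auto simp: remove_verts_def)
  have "num_components ?P = 1"
    using fin_digraph.num_components_eq_1_iff[OF fP] connected_power_graph[OF assms(1,2)] assms(3) V by auto
  moreover have "num_components ?H > 0"
  proof -
    obtain u where "u \<in> verts ?H" using ne by blast
    then have "H.sccs_verts \<noteq> {}" using H.scc_of_in_sccs_verts by blast
    then show ?thesis
      using H.finite_sccs_verts by (simp add: num_components_def card_gt_0_iff flip: H.card_sccs_verts)
  qed
  ultimately have "separating_set ?P S \<longleftrightarrow> num_components ?H \<noteq> 1"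
    using assms(3) V by (auto simp: separating_set_def)
  also have "\<dots> \<longleftrightarrow> \<not> strongly_connected ?H" using H.num_components_eq_1_iff[OF ne] by simp
  also have "\<dots> \<longleftrightarrow> \<not> connected ?H"
  proof -
    have "connected ?H" if "strongly_connected ?H"
      unfolding connected_def
    proof (rule strongly_connectedI)
      show "verts (with_proj (mk_symmetric ?H)) \<noteq> {}" using ne by simp
      fix u v assume "u \<in> verts (with_proj (mk_symmetric ?H))" "v \<in> verts (with_proj (mk_symmetric ?H))"
      then have "u \<rightarrow>\<^sup>*\<^bsub>?H\<^esub> v" using that by (simp add: strongly_connected_def)
      then show "u \<rightarrow>\<^sup>*\<^bsub>with_proj (mk_symmetric ?H)\<^esub> v" by (rule H.reachable_mk_symmetricI)
    qed
    then show ?thesis using H.symmetric_connected_imp_strongly_connected[OF sym] by blast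
  qed
  finally show ?thesis .
qed

end

theory Submission
  imports Defs
begin

text \<open>
  Two elements that generate the same cyclic subgroup are closed twins in the power graph: in a
  finite group, adjacency of distinct elements just says that one of the generated cyclic subgroups
  contains the other (\<open>adjacent_power_graph_iff\<close>), so it sees an element only through the
  subgroup that it generates. A minimal separating set \<open>T\<close> cannot split a pair of closed
  twins. Suppose that \<open>x \<in> T\<close> has a twin \<open>y \<notin> T\<close>. By minimality, removing
  \<open>T - {x}\<close> leaves a connected graph; this also holds if \<open>T = {x}\<close>, where minimality says
  nothing, because the whole power graph is connected through the identity. In this connected graph
  every walk can be rerouted through \<open>y\<close> wherever it visits \<open>x\<close>, so deleting \<open>x\<close> as well
  keeps it connected (\<open>strongly_connected_remove_insert\<close>). Hence \<open>T\<close> does not separate, a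
  contradiction.
\<close>

lemma dominates_remove_verts_iff:
  "u \<rightarrow>\<^bsub>remove_verts \<Gamma> S\<^esub> v \<longleftrightarrow> u \<rightarrow>\<^bsub>\<Gamma>\<^esub> v \<and> u \<in> verts \<Gamma> - S \<and> v \<in> verts \<Gamma> - S"
  by (auto simp: remove_verts_def arcs_ends_conv)

lemma remove_verts_empty:
  assumes "wf_digraph \<Gamma>"
  shows "remove_verts \<Gamma> {} = \<Gamma>"
proof -
  interpret wf_digraph \<Gamma> by fact
  have "{e \<in> arcs \<Gamma>. tail \<Gamma> e \<in> verts \<Gamma> \<and> head \<Gamma> e \<in> verts \<Gamma>} = arcs \<Gamma>"
    using wellformed by blast
  then show ?thesis by (simp add: remove_verts_def induce_subgraph_def)
qed

text \<open>
  The map that sends \<open>x\<close> to \<open>y\<close> and fixes all other vertices takes walks that avoid \<open>S\<close> to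
  walks that avoid \<open>x\<close> as well, up to steps that collapse to the single vertex \<open>y\<close>. In
  the absence of loops these are the steps between \<open>x\<close> and \<open>y\<close>, which the conditions \<open>u \<noteq> y\<close> and
  \<open>v \<noteq> y\<close> exclude; without them the lemma would require a loop at \<open>y\<close> and say nothing about
  adjacent twins in simple graphs.
\<close>

lemma strongly_connected_remove_insert:
  assumes "wf_digraph \<Gamma>" and sc: "strongly_connected (remove_verts \<Gamma> S)"
    and y: "y \<in> verts \<Gamma>" "y \<notin> insert x S"
    and into: "\<And>u. u \<rightarrow>\<^bsub>\<Gamma>\<^esub> x \<Longrightarrow> u \<noteq> y \<Longrightarrow> u \<rightarrow>\<^bsub>\<Gamma>\<^esub> y"
    and out: "\<And>v. x \<rightarrow>\<^bsub>\<Gamma>\<^esub> v \<Longrightarrow> v \<noteq> y \<Longrightarrow> y \<rightarrow>\<^bsub>\<Gamma>\<^esub> v"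
  shows "strongly_connected (remove_verts \<Gamma> (insert x S))" (is "strongly_connected ?H'")
proof -
  let ?H = "remove_verts \<Gamma> S"
  have V: "verts ?H = verts \<Gamma> - S" "verts ?H' = verts \<Gamma> - insert x S"
    by (simp_all add: remove_verts_def)
  interpret H: wf_digraph ?H
    unfolding remove_verts_def using assms(1) by (rule wf_digraph.wellformed_induce_subgraph)
  interpret H': wf_digraph ?H'
    unfolding remove_verts_def using assms(1) by (rule wf_digraph.wellformed_induce_subgraph)
  define f where "f w = (if w = x then y else w)" for w
  have fV: "f w \<in> verts ?H'" if "w \<in> verts ?H" for w
    using that y by (auto simp: f_def V)
  have reroute: "f u \<rightarrow>\<^sup>*\<^bsub>?H'\<^esub> f v" if "u \<rightarrow>\<^sup>*\<^bsub>?H\<^esub> v" for u v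
    using that
  proof (induction rule: H.reachable_induct)
    case base
    then show ?case by (rule H'.reachable_refl[OF fV])
  next
    case (step v w)
    then have vw: "v \<rightarrow>\<^bsub>\<Gamma>\<^esub> w" "v \<in> verts ?H" "w \<in> verts ?H"
      by (auto simp: dominates_remove_verts_iff V)
    have "f v \<rightarrow>\<^sup>*\<^bsub>?H'\<^esub> f w"
    proof (cases "f v = f w")
      case True
      then show ?thesis using fV[OF vw(2)] by (simp add: H'.reachable_refl)
    next
      case False
      then have "f v \<rightarrow>\<^bsub>\<Gamma>\<^esub> f w"
        using vw(1) into[of v] out[of w] by (auto simp: f_def split: if_splits)
      then have "f v \<rightarrow>\<^bsub>?H'\<^esub> f w"
        using fV[OF vw(2)] fV[OF vw(3)] by (simp only: dominates_remove_verts_iff V)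
      then show ?thesis by (rule H'.reachable_adjI)
    qed
    with step.IH show ?case by (rule H'.reachable_trans)
  qed
  show ?thesis
  proof (rule strongly_connectedI)
    show "verts ?H' \<noteq> {}" using y V by auto
    fix u v assume uv: "u \<in> verts ?H'" "v \<in> verts ?H'"
    then have "u \<rightarrow>\<^sup>*\<^bsub>?H\<^esub> v" using sc V by (auto simp: strongly_connected_def)
    then have "f u \<rightarrow>\<^sup>*\<^bsub>?H'\<^esub> f v" by (rule reroute)
    with uv show "u \<rightarrow>\<^sup>*\<^bsub>?H'\<^esub> v" using V by (auto simp: f_def)
  qed
qed

text \<open>
  Arcs come in opposite pairs, so being connected and being strongly connected agree; the latter
  speaks of walks in the graph itself, which is what rerouting needs.
\<close>

lemma separating_set_power_graph_iff_strongly_connected: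
  assumes "group G" "finite (carrier G)" "S \<subset> carrier G"
  shows "separating_set (with_proj (power_graph G)) S \<longleftrightarrow>
    \<not> strongly_connected (remove_verts (with_proj (power_graph G)) S)"
proof -
  let ?P = "with_proj (power_graph G)"
  let ?H = "remove_verts ?P S"
  interpret P: pair_graph "power_graph G" by (rule pair_graph_power_graph) fact
  have wP: "wf_digraph ?P" by unfold_locales
  have ind: "induced_subgraph ?H ?P"
    unfolding remove_verts_def by (rule wf_digraph.induced_induce[OF wP]) auto
  interpret H: wf_digraph ?H
    unfolding remove_verts_def using wP by (rule wf_digraph.wellformed_induce_subgraph)
  have sym: "symmetric ?H" using P.sym_arcs ind by (rule induced_graph_imp_symmetric)
  have "connected ?H" if sc: "strongly_connected ?H"
    unfolding connected_def
  proof (rule strongly_connectedI)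
    show "verts (with_proj (mk_symmetric ?H)) \<noteq> {}"
      using sc by (simp add: strongly_connected_def)
    fix u v
    assume "u \<in> verts (with_proj (mk_symmetric ?H))" "v \<in> verts (with_proj (mk_symmetric ?H))"
    then have "u \<rightarrow>\<^sup>*\<^bsub>?H\<^esub> v" using sc by (simp add: strongly_connected_def)
    then show "u \<rightarrow>\<^sup>*\<^bsub>with_proj (mk_symmetric ?H)\<^esub> v" by (rule H.reachable_mk_symmetricI)
  qed
  then have "connected ?H \<longleftrightarrow> strongly_connected ?H"
    using H.symmetric_connected_imp_strongly_connected[OF sym] by blast
  then show ?thesis using separating_set_power_graph_iff[OF assms] by simp
qed

text \<open>
  An element of a finite group has finite order, so the positive powers of \<open>u\<close> already exhaust
  \<open>\<langle>u\<rangle>\<close>.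
\<close>

lemma (in group) positive_power_iff_generate_subset:
  assumes "finite (carrier G)" and u: "u \<in> carrier G" and v: "v \<in> carrier G"
  shows "(\<exists>\<alpha>::nat. \<alpha> > 0 \<and> v = u [^] \<alpha>) \<longleftrightarrow> generate G {v} \<subseteq> generate G {u}"
proof -
  have gen: "generate G {u} = {u [^] k | k::nat. k \<in> UNIV}"
    using generate_pow_on_finite_carrier[OF assms(1) u] .
  have "(\<exists>\<alpha>::nat. \<alpha> > 0 \<and> v = u [^] \<alpha>) \<longleftrightarrow> v \<in> generate G {u}"
  proof
    assume "v \<in> generate G {u}"
    then obtain k :: nat where "v = u [^] k" unfolding gen by blast
    \<comment> \<open>Adding the order makes the exponent positive, also for \<open>k = 0\<close>.\<close>
    then have "v = u [^] (k + ord u)"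
      using u by (simp add: pow_ord_eq_1 flip: nat_pow_mult)
    moreover have "k + ord u > 0" using ord_ge_1[OF assms(1) u] by simp
    ultimately show "\<exists>\<alpha>::nat. \<alpha> > 0 \<and> v = u [^] \<alpha>" by blast
  qed (auto simp: gen)
  also have "\<dots> \<longleftrightarrow> generate G {v} \<subseteq> generate G {u}"
    using generate_subgroup_incl[of "{v}" "generate G {u}"] generate_is_subgroup[of "{u}"] u
      generate.incl[of v "{v}" G] by auto
  finally show ?thesis .
qed

lemma adjacent_power_graph_iff:
  assumes "group G" "finite (carrier G)"
  shows "u \<rightarrow>\<^bsub>with_proj (power_graph G)\<^esub> v \<longleftrightarrow>
    u \<in> carrier G \<and> v \<in> carrier G \<and> u \<noteq> v \<and>
    (generate G {u} \<subseteq> generate G {v} \<or> generate G {v} \<subseteq> generate G {u})"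
proof -
  have "u \<rightarrow>\<^bsub>with_proj (power_graph G)\<^esub> v \<longleftrightarrow> (u, v) \<in> parcs (power_graph G)"
    by (auto simp: arcs_ends_conv)
  then show ?thesis
    using group.positive_power_iff_generate_subset[OF assms] by (auto simp: power_graph_def)
qed

lemma minimal_separating_set_power_graph_closed:
  assumes "group G" "finite (carrier G)"
    and min: "minimal_separating_set (with_proj (power_graph G)) T"
    and x: "x \<in> T" and xy: "(x, y) \<in> same_cyclic_rel G"
  shows "y \<in> T"
proof (rule ccontr)
  let ?P = "with_proj (power_graph G)"
  assume y: "y \<notin> T"
  have V: "verts ?P = carrier G" by (simp add: power_graph_def)
  interpret P: pair_graph "power_graph G" by (rule pair_graph_power_graph) fact
  have wP: "wf_digraph ?P" by unfold_locales
  have yG: "y \<in> carrier G" and gen: "generate G {x} = generate G {y}"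
    using xy by (auto simp: same_cyclic_rel_def)
  have sep: "separating_set ?P T" using min by (simp add: minimal_separating_set_def)
  then have T: "T \<subset> carrier G" using V y yG by (auto simp: separating_set_def)
  let ?S = "T - {x}"
  have "\<not> separating_set ?P ?S"
  proof (cases "?S = {}")
    case True
    then show ?thesis by (simp only: True separating_set_def remove_verts_empty[OF wP]) simp
  next
    case False
    then show ?thesis using min x by (auto simp: minimal_separating_set_def)
  qed
  then have "strongly_connected (remove_verts ?P ?S)"
    using separating_set_power_graph_iff_strongly_connected[OF assms(1,2), of ?S] T by blast
  with wP have "strongly_connected (remove_verts ?P (insert x ?S))"
  proof (rule strongly_connected_remove_insert)
    show "y \<in> verts ?P" "y \<notin> insert x ?S" using yG y x V by auto
  qed (use gen yG in \<open>simp_all only: adjacent_power_graph_iff[OF assms(1,2)], blast+\<close>)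
  then have "strongly_connected (remove_verts ?P T)" using x by (simp add: insert_absorb)
  then show False
    using sep separating_set_power_graph_iff_strongly_connected[OF assms(1,2) T] by blast
qed

theorem theorem2p10:
  fixes G :: "('a, 'b) monoid_scheme" and T :: "'a set"
  assumes "group G" and "finite (carrier G)"
    and "minimal_separating_set (with_proj (power_graph G)) T"
  shows "(\<forall>x \<in> carrier G. same_cyclic_rel G `` {x} \<subseteq> T \<or> same_cyclic_rel G `` {x} \<inter> T = {})
    \<and> (\<exists>\<C>. \<C> \<subseteq> carrier G // same_cyclic_rel G \<and> T = \<Union>\<C>)"
proof -
  let ?R = "same_cyclic_rel G" and ?P = "with_proj (power_graph G)"
  note closed = minimal_separating_set_power_graph_closed[OF assms]
  have "separating_set ?P T" using assms(3) by (simp add: minimal_separating_set_def)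
  then have sub: "T \<subseteq> carrier G" by (simp add: separating_set_def power_graph_def)
  have "?R `` {x} \<subseteq> T \<or> ?R `` {x} \<inter> T = {}" for x
  proof -
    have "z \<in> T" if "y \<in> T" "(x, y) \<in> ?R" "(x, z) \<in> ?R" for y z
    proof (rule closed[OF that(1)])
      show "(y, z) \<in> ?R" using that(2,3) by (simp add: same_cyclic_rel_def)
    qed
    then show ?thesis by blast
  qed
  moreover have "\<exists>\<C>. \<C> \<subseteq> carrier G // ?R \<and> T = \<Union>\<C>"
  proof (intro exI conjI)
    show "(\<lambda>x. ?R `` {x}) ` T \<subseteq> carrier G // ?R"
      using sub by (blast intro: quotientI)
    show "T = \<Union>((\<lambda>x. ?R `` {x}) ` T)"
    proof
      show "T \<subseteq> \<Union>((\<lambda>x. ?R `` {x}) ` T)"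
        using equiv_class_self[OF equiv_same_cyclic_rel[of G]] sub by blast
      show "\<Union>((\<lambda>x. ?R `` {x}) ` T) \<subseteq> T" using closed by blast
    qed
  qed
  ultimately show ?thesis by blast
qed

end
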